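(* Let $\mathbb T^{2n}=\mathbb C^n/\mathbb Z^{2n}$ be the standard complex torus of real dimension $2n$, with coordinates $z_\alpha=x_\alpha+ix_{\alpha+n}$, $\alpha=1,\dots,n$, standard complex structure $J_n$ and symplectic form $\omega_n=\frac i2\sum_{\alpha=1}^n dz_\alpha\wedge d\overline z_\alpha$. Then the $\omega_n$-admissible complex structure $J_n$ is not rigid, i.e. $TV_{[J_n]}\mathfrak M(\mathcal{AC}_{\omega_n}(\mathbb T^{2n}))\neq\{0\}$.
   Context: For an almost complex structure $J$ on a $2n$-dimensional manifold $M$, $\Lambda^{p,q}_J(M)$ denotes the (smooth) complex forms of type $(p,q)$. The exterior derivative on $(p,q)$-forms splits as $d=A_J+\partial_J+\overline\partial_J+\overline A_J$, with components of types $(p+2,q-1)$, $(p+1,q)$, $(p,q+1)$, $(p-1,q+2)$ respectively. A superscript $(\cdot)^{p,q}$ denotes projection onto $\Lambda^{p,q}_J(M)$. Let $(M,\omega)$ be a symplectic manifold of dimension $2n$. An almost complex structure $J$ is $\omega$-calibrated if $\omega(J\cdot,J\cdot)=\omega(\cdot,\cdot)$ and $\omega(v,Jv)>0$ for all $v\neq0$; then $g_J(v,w)=\omega(v,Jw)$ is a Riemannian metric, and ${}^tL$ denotes the transpose of $L\in\mathrm{End}(TM)$ with respect to $g_J$. An $\omega$-calibrated $J$ is $\omega$-admissible if there is a nowhere vanishing $\psi\in\Lambda^{n,0}_J(M)$ with $\overline\partial_J\psi=0$; $\mathcal{AC}_\omega(M)$ is the set of these. (For the torus, $\psi_n=dz_1\wedge\dots\wedge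 dz_n$ shows that $J_n$ is $\omega_n$-admissible.) The moduli space $\mathfrak M(\mathcal{AC}_\omega(M))$ is the quotient of $\mathcal{AC}_\omega(M)$ by the group of symplectomorphisms of $(M,\omega)$ acting by $(\phi,J)\mapsto\phi_*^{-1}\circ J\circ\phi_*$. For $L\in\mathrm{End}(TM)$ (extended complex-linearly), $\tau_L\gamma(X_1,\dots,X_r)=\sum_i\gamma(X_1,\dots,LX_i,\dots,X_r)$. For $L\in\mathrm{End}(TM)$ anticommuting with $J$ and nowhere vanishing $\psi\in\Lambda^{n,0}_J(M)$, let $\mu_L(\psi),\gamma_L(\psi)$ be the unique $(0,1)$-forms with $(\tau_L\overline A_J\psi)^{n,1}=\mu_L(\psi)\wedge\psi$ and $\partial_J\tau_L\psi=\gamma_L(\psi)\wedge\psi$, and set $\theta_L(\psi):=\mu_L(\psi)-\gamma_L(\psi)$. When $M$ is compact, $\theta_L(\psi)$ is the same for all nowhere vanishing $\overline\partial_J$-closed $\psi\in\Lambda^{n,0}_J(M)$ and is denoted $\theta_L$. "$\overline\partial_J$-exact" means equal to $\overline\partial_Jh$ for some $h\in C^\infty(M,\mathbb C)$. For $M$ compact and $J\in\mathcal{AC}_\omega(M)$, the virtual tangent space to the moduli space at $[J]$ is the vector space $$TV_{[J]}\mathfrak M(\mathcal{AC}_\omega(M)):=\frac{\{JL\in\mathrm{End}(TM)\;|\;L={}^tL,\ LJ=-JL,\ \theta_L\text{ is }\overline\partial_J\text{-exact}\}}{\{\mathcal L_XJ\;|\;X\text{ a vector field on }M\text{ with }\mathcal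 L_X\omega=0\}},$$ and $J$ is called rigid if $TV_{[J]}\mathfrak M(\mathcal{AC}_\omega(M))=\{0\}$. *)

theory Defs
  imports "HOL-Analysis.Analysis"
begin

section \<open>Tensor fields on the torus\<close>

text \<open>
  The torus is the quotient of \<^typ>\<open>real ^ ('n + 'n)\<close> by the integer lattice, where \<open>CARD('n) = n\<close>;
  the coordinates \<open>x_\<alpha>\<close> and \<open>x_{\<alpha>+n}\<close> carry the indices \<^term>\<open>Inl \<alpha>\<close> and \<^term>\<open>Inr \<alpha>\<close>.
  The coordinate fields descend to a global frame of the tangent bundle, so tensor fields on the
  torus are exactly the lattice-periodic tensor fields on \<^typ>\<open>real ^ ('n + 'n)\<close>, and
  \<open>TM \<otimes> \<complex>\<close> has fibre \<^typ>\<open>complex ^ ('n + 'n)\<close>.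
\<close>

type_synonym 'n rvec = "(real, 'n + 'n) vec"
type_synonym 'n cvec = "(complex, 'n + 'n) vec"
type_synonym 'n vfield = "'n rvec \<Rightarrow> 'n rvec"
type_synonym 'n endo = "'n rvec \<Rightarrow> ('n rvec, 'n + 'n) vec"
type_synonym 'n bilin = "'n rvec \<Rightarrow> 'n rvec \<Rightarrow> 'n rvec \<Rightarrow> real"

text \<open>A complex form of degree \<open>r\<close> takes a base point and a list of \<open>r\<close> complex tangent vectors.\<close>

type_synonym 'n cform = "'n rvec \<Rightarrow> 'n cvec list \<Rightarrow> complex"

primrec Ck :: "nat \<Rightarrow> ('a::real_normed_vector \<Rightarrow> 'b::real_normed_vector) \<Rightarrow> bool" where
  "Ck 0 f \<longleftrightarrow> continuous_on UNIV f"
| "Ck (Suc k) f \<longleftrightarrow>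
     (\<forall>x. f differentiable (at x)) \<and> (\<forall>v. Ck k (\<lambda>x. frechet_derivative f (at x) v))"

definition smooth :: "('a::real_normed_vector \<Rightarrow> 'b::real_normed_vector) \<Rightarrow> bool" where
  "smooth f \<longleftrightarrow> (\<forall>k. Ck k f)"

definition periodic :: "('n::finite rvec \<Rightarrow> 'b) \<Rightarrow> bool" where
  "periodic f \<longleftrightarrow> (\<forall>x k. (\<forall>i. k $ i \<in> \<int>) \<longrightarrow> f (x + k) = f x)"

definition cfunctions :: "('n::finite rvec \<Rightarrow> complex) set" where
  "cfunctions = {h. smooth h \<and> periodic h}"

definition vfields :: "'n::finite vfield set" where
  "vfields = {X. smooth X \<and> periodic X}"

definition endos :: "'n::finite endo set" where
  "endos = {L. smooth L \<and> periodic L}"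

definition cvec_of :: "'n::finite rvec \<Rightarrow> 'n cvec" where
  "cvec_of v = (\<chi> i. complex_of_real (v $ i))"

definition cmat_of :: "('n::finite rvec, 'n + 'n) vec \<Rightarrow> ('n cvec, 'n + 'n) vec" where
  "cmat_of A = (\<chi> i j. complex_of_real (A $ i $ j))"

text \<open>
  Forms vanish by convention on lists of the wrong length, so that equality of forms is
  equality of functions.
\<close>

definition cforms :: "nat \<Rightarrow> 'n::finite cform set" where
  "cforms r = {\<alpha>. periodic \<alpha> \<and> (\<forall>vs. smooth (\<lambda>x. \<alpha> x vs)) \<and>
     (\<forall>x vs. length vs \<noteq> r \<longrightarrow> \<alpha> x vs = 0) \<and>
     (\<forall>x vs i u v. length vs = r \<and> i < r \<longrightarrow>
        \<alpha> x (vs[i := u + v]) = \<alpha> x (vs[i := u]) + \<alpha> x (vs[i := v])) \<and>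
     (\<forall>x vs i c v. length vs = r \<and> i < r \<longrightarrow>
        \<alpha> x (vs[i := c *s v]) = c * \<alpha> x (vs[i := v])) \<and>
     (\<forall>x vs i j. length vs = r \<and> i < j \<and> j < r \<and> vs ! i = vs ! j \<longrightarrow> \<alpha> x vs = 0)}"

definition form_of_fun :: "('n::finite rvec \<Rightarrow> complex) \<Rightarrow> 'n cform" where
  "form_of_fun h x vs = (if vs = [] then h x else 0)"

definition omit :: "nat \<Rightarrow> 'a list \<Rightarrow> 'a list" where
  "omit i vs = take i vs @ drop (Suc i) vs"

text \<open>The normalisation is \<open>(\<mu> \<and> \<nu>)(v, w) = \<mu>(v) \<nu>(w) - \<mu>(w) \<nu>(v)\<close> for 1-forms.\<close>

definition wedge1 :: "'n::finite cform \<Rightarrow> 'n cform \<Rightarrow> 'n cform" where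
  "wedge1 \<mu> \<alpha> x vs = (\<Sum>i<length vs. (-1) ^ i * \<mu> x [vs ! i] * \<alpha> x (omit i vs))"

definition cderiv :: "'n::finite cvec \<Rightarrow> ('n rvec \<Rightarrow> complex) \<Rightarrow> 'n rvec \<Rightarrow> complex" where
  "cderiv u f x = (\<Sum>j\<in>UNIV. u $ j * frechet_derivative f (at x) (axis j 1))"

text \<open>
  The invariant formula for \<open>d\<close>, evaluated on constant vector fields, whose brackets vanish.
\<close>

definition ext_d :: "'n::finite cform \<Rightarrow> 'n cform" where
  "ext_d \<alpha> x vs = (\<Sum>i<length vs. (-1) ^ i * cderiv (vs ! i) (\<lambda>y. \<alpha> y (omit i vs)) x)"

definition lie_bracket :: "'n::finite vfield \<Rightarrow> 'n vfield \<Rightarrow> 'n vfield" where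
  "lie_bracket X Y x =
     frechet_derivative Y (at x) (X x) - frechet_derivative X (at x) (Y x)"

definition lie_endo :: "'n::finite vfield \<Rightarrow> 'n endo \<Rightarrow> 'n endo" where
  "lie_endo X J x =
     matrix (\<lambda>v. lie_bracket X (\<lambda>y. J y *v v) x - J x *v lie_bracket X (\<lambda>_. v) x)"

definition lie_bilin :: "'n::finite vfield \<Rightarrow> 'n bilin \<Rightarrow> 'n bilin" where
  "lie_bilin X \<omega> x v w =
     frechet_derivative (\<lambda>y. \<omega> y v w) (at x) (X x)
     - \<omega> x (lie_bracket X (\<lambda>_. v) x) w - \<omega> x v (lie_bracket X (\<lambda>_. w) x)"


section \<open>Almost complex structures and types of forms\<close>

definition almost_complex :: "'n::finite endo \<Rightarrow> bool" where
  "almost_complex J \<longleftrightarrow> J \<in> endos \<and> (\<forall>x. J x ** J x = - mat 1)"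

text \<open>The projections of \<open>TM \<otimes> \<complex>\<close> onto the eigenbundles of \<open>J\<close> for \<open>\<i>\<close> and \<open>-\<i>\<close>.\<close>

definition proj10 :: "'n::finite endo \<Rightarrow> 'n rvec \<Rightarrow> 'n cvec \<Rightarrow> 'n cvec" where
  "proj10 J x v = (1/2) *s (v - \<i> *s (cmat_of (J x) *v v))"

definition proj01 :: "'n::finite endo \<Rightarrow> 'n rvec \<Rightarrow> 'n cvec \<Rightarrow> 'n cvec" where
  "proj01 J x v = (1/2) *s (v + \<i> *s (cmat_of (J x) *v v))"

text \<open>
  The component of type \<open>(p,q)\<close>: expand each argument as \<open>v = v\<^sup>1\<^sup>0 + v\<^sup>0\<^sup>1\<close> and keep the terms with
  exactly \<open>p\<close> arguments of type \<open>(1,0)\<close>.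
\<close>

definition type_proj :: "'n::finite endo \<Rightarrow> nat \<Rightarrow> nat \<Rightarrow> 'n cform \<Rightarrow> 'n cform" where
  "type_proj J p q \<alpha> x vs =
     (if length vs = p + q
      then \<Sum>S | S \<subseteq> {..<p + q} \<and> card S = p.
             \<alpha> x (map (\<lambda>i. if i \<in> S then proj10 J x (vs ! i) else proj01 J x (vs ! i)) [0..<p + q])
      else 0)"

definition Lambda :: "'n::finite endo \<Rightarrow> nat \<Rightarrow> nat \<Rightarrow> 'n cform set" where
  "Lambda J p q = {\<alpha> \<in> cforms (p + q). type_proj J p q \<alpha> = \<alpha>}"

text \<open>Components of \<open>d\<close> on forms of type \<open>(p,q)\<close>.\<close>

definition del :: "'n::finite endo \<Rightarrow> nat \<Rightarrow> nat \<Rightarrow> 'n cform \<Rightarrow> 'n cform" where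
  "del J p q \<alpha> = type_proj J (p + 1) q (ext_d \<alpha>)"

definition delbar :: "'n::finite endo \<Rightarrow> nat \<Rightarrow> nat \<Rightarrow> 'n cform \<Rightarrow> 'n cform" where
  "delbar J p q \<alpha> = type_proj J p (q + 1) (ext_d \<alpha>)"

definition Abar :: "'n::finite endo \<Rightarrow> nat \<Rightarrow> nat \<Rightarrow> 'n cform \<Rightarrow> 'n cform" where
  "Abar J p q \<alpha> =
     (if p = 0 then (\<lambda>x vs. 0) else type_proj J (p - 1) (q + 2) (ext_d \<alpha>))"

definition nowhere_vanishing :: "'n::finite cform \<Rightarrow> bool" where
  "nowhere_vanishing \<psi> \<longleftrightarrow> (\<forall>x. \<exists>vs. \<psi> x vs \<noteq> 0)"

definition closed_volume_forms :: "'n::finite endo \<Rightarrow> 'n cform set" where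
  "closed_volume_forms J =
     {\<psi> \<in> Lambda J CARD('n) 0. nowhere_vanishing \<psi> \<and> delbar J CARD('n) 0 \<psi> = (\<lambda>x vs. 0)}"

definition delbar_exact :: "'n::finite endo \<Rightarrow> 'n cform \<Rightarrow> bool" where
  "delbar_exact J \<theta> \<longleftrightarrow> (\<exists>h\<in>cfunctions. \<theta> = delbar J 0 0 (form_of_fun h))"


section \<open>Calibrated and admissible structures\<close>

definition calibrated :: "'n::finite bilin \<Rightarrow> 'n endo \<Rightarrow> bool" where
  "calibrated \<omega> J \<longleftrightarrow> almost_complex J \<and>
     (\<forall>x v w. \<omega> x (J x *v v) (J x *v w) = \<omega> x v w) \<and>
     (\<forall>x v. v \<noteq> 0 \<longrightarrow> \<omega> x v (J x *v v) > 0)"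

definition admissible :: "'n::finite bilin \<Rightarrow> 'n endo set" where
  "admissible \<omega> = {J. calibrated \<omega> J \<and> closed_volume_forms J \<noteq> {}}"

definition metric_of :: "'n::finite bilin \<Rightarrow> 'n endo \<Rightarrow> 'n bilin" where
  "metric_of \<omega> J x v w = \<omega> x v (J x *v w)"

definition transpose_wrt :: "'n::finite bilin \<Rightarrow> 'n endo \<Rightarrow> 'n endo" where
  "transpose_wrt g L x = (THE M. \<forall>v w. g x (L x *v v) w = g x v (M *v w))"


section \<open>The virtual tangent space to the moduli space\<close>

definition tau :: "'n::finite endo \<Rightarrow> 'n cform \<Rightarrow> 'n cform" where
  "tau L \<alpha> x vs = (\<Sum>i<length vs. \<alpha> x (vs[i := cmat_of (L x) *v (vs ! i)]))"

definition mu_form :: "'n::finite endo \<Rightarrow> 'n endo \<Rightarrow> 'n cform \<Rightarrow> 'n cform" where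
  "mu_form J L \<psi> = (THE \<mu>. \<mu> \<in> Lambda J 0 1 \<and>
     type_proj J CARD('n) 1 (tau L (Abar J CARD('n) 0 \<psi>)) = wedge1 \<mu> \<psi>)"

text \<open>\<open>\<tau>\<^sub>L \<psi>\<close> has type \<open>(n-1,1)\<close>, since \<open>L\<close> anticommutes with \<open>J\<close>.\<close>

definition gamma_form :: "'n::finite endo \<Rightarrow> 'n endo \<Rightarrow> 'n cform \<Rightarrow> 'n cform" where
  "gamma_form J L \<psi> = (THE \<gamma>. \<gamma> \<in> Lambda J 0 1 \<and>
     del J (CARD('n) - 1) 1 (tau L \<psi>) = wedge1 \<gamma> \<psi>)"

definition theta_form :: "'n::finite endo \<Rightarrow> 'n endo \<Rightarrow> 'n cform \<Rightarrow> 'n cform" where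
  "theta_form J L \<psi> x vs = mu_form J L \<psi> x vs - gamma_form J L \<psi> x vs"

definition theta :: "'n::finite endo \<Rightarrow> 'n endo \<Rightarrow> 'n cform" where
  "theta J L = (THE \<theta>. \<forall>\<psi>\<in>closed_volume_forms J. theta_form J L \<psi> = \<theta>)"

definition inf_deformations :: "'n::finite bilin \<Rightarrow> 'n endo \<Rightarrow> 'n endo set" where
  "inf_deformations \<omega> J = {(\<lambda>x. J x ** L x) | L. L \<in> endos \<and>
     L = transpose_wrt (metric_of \<omega> J) L \<and> (\<forall>x. L x ** J x = - (J x ** L x)) \<and>
     delbar_exact J (theta J L)}"

definition trivial_deformations :: "'n::finite bilin \<Rightarrow> 'n endo \<Rightarrow> 'n endo set" where
  "trivial_deformations \<omega> J =
     {lie_endo X J | X. X \<in> vfields \<and> (\<forall>x v w. lie_bilin X \<omega> x v w = 0)}"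

definition endo_coset :: "'n::finite endo set \<Rightarrow> 'n endo \<Rightarrow> 'n endo set" where
  "endo_coset D A = {(\<lambda>x. A x + B x) | B. B \<in> D}"

definition virtual_tangent :: "'n::finite bilin \<Rightarrow> 'n endo \<Rightarrow> 'n endo set set" where
  "virtual_tangent \<omega> J = endo_coset (trivial_deformations \<omega> J) ` inf_deformations \<omega> J"

definition rigid :: "'n::finite bilin \<Rightarrow> 'n endo \<Rightarrow> bool" where
  "rigid \<omega> J \<longleftrightarrow> virtual_tangent \<omega> J = {endo_coset (trivial_deformations \<omega> J) (\<lambda>x. 0)}"


section \<open>The standard structures\<close>

definition dz :: "'n::finite \<Rightarrow> 'n cform" where
  "dz \<alpha> x vs = (case vs of [v] \<Rightarrow> v $ Inl \<alpha> + \<i> * v $ Inr \<alpha> | _ \<Rightarrow> 0)"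

definition dzbar :: "'n::finite \<Rightarrow> 'n cform" where
  "dzbar \<alpha> x vs = (case vs of [v] \<Rightarrow> v $ Inl \<alpha> - \<i> * v $ Inr \<alpha> | _ \<Rightarrow> 0)"

definition J_std :: "'n::finite endo" where
  "J_std x = matrix (\<lambda>v. \<chi> k. case k of Inl \<alpha> \<Rightarrow> - v $ Inr \<alpha> | Inr \<alpha> \<Rightarrow> v $ Inl \<alpha>)"

definition omega_cform :: "'n::finite cform" where
  "omega_cform x vs = \<i> / 2 * (\<Sum>\<alpha>\<in>UNIV. wedge1 (dz \<alpha>) (dzbar \<alpha>) x vs)"

definition omega_std :: "'n::finite bilin" where
  "omega_std x v w = Re (omega_cform x [cvec_of v, cvec_of w])"

lemma omega_cform_real:
  "omega_cform x [cvec_of v, cvec_of w] = complex_of_real (omega_std x v w)"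
  by (auto simp: complex_eq_iff omega_std_def omega_cform_def wedge1_def omit_def dz_def
      dzbar_def cvec_of_def lessThan_Suc algebra_simps intro!: sum.neutral)

lemma J_std_times: "J_std x *v v = (\<chi> k. case k of Inl \<alpha> \<Rightarrow> - v $ Inr \<alpha> | Inr \<alpha> \<Rightarrow> v $ Inl \<alpha>)"
proof -
  have "linear (\<lambda>v::'a rvec. \<chi> k. case k of Inl \<alpha> \<Rightarrow> - v $ Inr \<alpha> | Inr \<alpha> \<Rightarrow> v $ Inl \<alpha>)"
    by (auto simp: linear_iff vec_eq_iff split: sum.splits)
  then show ?thesis
    by (simp add: J_std_def matrix_works linear_matrix_vector_mul_eq)
qed

lemma dz_J_std: "dz \<alpha> x [cvec_of (J_std x *v v)] = \<i> * dz \<alpha> x [cvec_of v]"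
  by (simp add: dz_def J_std_times cvec_of_def algebra_simps complex_eq_iff)

end

(*
  Along each complex coordinate line, a coefficient of a delbar-closed (n,0)-form on the torus is a
  bounded entire function, so closed volume forms have constant coefficients by Liouville.  Hence
  theta_L = 0 for every constant L.  Take for L complex conjugation.  If J L were L_X J for a
  symplectic vector field X, its component X_x in the direction x_1 would satisfy dX_x/dx_1 = 1/2,
  which is impossible for a periodic function.
*)
theory Submission
  imports Defs "HOL-Complex_Analysis.Cauchy_Integral_Formula"
begin

section \<open>Smooth periodic functions\<close>

lemma smooth_const: "smooth (\<lambda>x::'a::real_normed_vector. c::'b::real_normed_vector)"
proof -
  have "Ck k (\<lambda>x::'a. c)" for k and c :: 'b
    by (induction k arbitrary: c) (simp_all add: frechet_derivative_const)
  then show ?thesis by (simp add: smooth_def)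
qed

lemma periodic_const: "periodic (\<lambda>x. c)"
  by (simp add: periodic_def)

lemma smooth_differentiable: "smooth f \<Longrightarrow> f differentiable (at x)"
  unfolding smooth_def by (metis Ck.simps(2))

lemma smooth_continuous: "smooth f \<Longrightarrow> continuous_on S f"
  unfolding smooth_def by (metis Ck.simps(1) continuous_on_subset subset_UNIV)

lemma cderiv_const: "cderiv u (\<lambda>x. c) x = 0"
  by (simp add: cderiv_def frechet_derivative_const)

text \<open>Every lattice orbit meets the closed unit cube: subtracting the integer parts moves
  \<open>x\<close> there. So all values of \<open>f\<close> are taken on a compact set.\<close>

lemma periodic_continuous_bounded:
  fixes f :: "'n::finite rvec \<Rightarrow> 'b::metric_space"
  assumes "periodic f" "continuous_on UNIV f"
  shows "bounded (range f)"
proof -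
  have "range f \<subseteq> f ` cbox 0 1"
  proof clarify
    fix x :: "'n rvec"
    define k :: "'n rvec" where "k = (\<chi> i. - of_int \<lfloor>x $ i\<rfloor>)"
    have "f (x + k) = f x"
      using assms(1) by (simp add: periodic_def k_def)
    moreover have "x + k \<in> cbox 0 1"
      by (simp add: mem_box_cart k_def) linarith
    ultimately show "f x \<in> f ` cbox 0 1" by (metis imageI)
  qed
  moreover have "compact (f ` cbox 0 1)"
    by (intro compact_continuous_image continuous_on_subset[OF assms(2)]) auto
  ultimately show ?thesis
    using bounded_subset compact_imp_bounded by blast
qed

section \<open>Algebra of types\<close>

lemma cmat_of_mult: "cmat_of (A ** B) = cmat_of A ** cmat_of B"
  by (simp add: cmat_of_def matrix_matrix_mult_def vec_eq_iff)

lemma matrix_vector_mult_minus: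
  fixes A :: "'a::ring_1 ^ 'n ^ 'm"
  shows matrix_vector_mult_minus_right: "A *v (- v) = - (A *v v)"
    and matrix_vector_mult_minus_left: "(- A) *v v = - (A *v v)"
  by (simp_all add: matrix_vector_mult_def vec_eq_iff sum_negf)

lemma cmat_of_square:
  assumes "A ** A = - mat 1"
  shows "cmat_of A *v (cmat_of A *v v) = - v"
proof -
  have "cmat_of A ** cmat_of A = - mat 1"
    unfolding cmat_of_mult[symmetric] assms by (simp add: cmat_of_def mat_def vec_eq_iff)
  then show ?thesis
    by (simp add: matrix_vector_mul_assoc matrix_vector_mult_minus)
qed

lemma
  fixes J :: "'n::finite endo" and x
  assumes "J x ** J x = - mat 1"
  shows proj10_proj10: "proj10 J x (proj10 J x v) = proj10 J x v"
    and proj01_proj01: "proj01 J x (proj01 J x v) = proj01 J x v"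
    and proj01_proj10: "proj01 J x (proj10 J x v) = 0"
    and proj10_proj01: "proj10 J x (proj01 J x v) = 0"
  by (simp_all add: proj10_def proj01_def cmat_of_square[OF assms] vec_eq_iff vector_scalar_commute
      matrix_vector_right_distrib matrix_vector_mult_diff_distrib algebra_simps)

lemma cforms_zero_arg:
  assumes "\<alpha> \<in> cforms r" "0 \<in> set vs"
  shows "\<alpha> x vs = 0"
proof (cases "length vs = r")
  case True
  obtain i where i: "i < length vs" "vs ! i = 0"
    using assms(2) by (auto simp: in_set_conv_nth)
  have "\<alpha> x (vs[i := 0 *s 0]) = 0 * \<alpha> x (vs[i := 0])"
    using assms(1) True i unfolding cforms_def by blast
  then show ?thesis using i by (metis list_update_id mult_zero_left vector_smult_lzero)
qed (use assms in \<open>simp add: cforms_def\<close>)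

text \<open>Only the full index set has p elements, so the sum in \<open>type_proj\<close> has a
  single term, in which every argument is replaced by its (1,0) part. \<open>Lambda_0q\<close> is
  the mirror case, where only the empty set is left.\<close>

lemma Lambda_p0:
  assumes "\<psi> \<in> Lambda J p 0" "length vs = p"
  shows "\<psi> x vs = \<psi> x (map (proj10 J x) vs)"
proof -
  have S: "{S. S \<subseteq> {..<p} \<and> card S = p} = {{..<p}}"
    using card_subset_eq[of "{..<p}"] by auto
  have "\<psi> x vs = type_proj J p 0 \<psi> x vs"
    using assms(1) by (simp add: Lambda_def)
  also have "\<dots> = \<psi> x (map (\<lambda>i. if i \<in> {..<p} then proj10 J x (vs ! i) else proj01 J x (vs ! i)) [0..<p])"
    using assms(2) by (simp add: type_proj_def S)
  also have "map (\<lambda>i. if i \<in> {..<p} then proj10 J x (vs ! i) else proj01 J x (vs ! i)) [0..<p]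
      = map (proj10 J x) vs"
    using assms(2) by (auto intro: nth_equalityI)
  finally show ?thesis .
qed

lemma Lambda_0q:
  assumes "\<mu> \<in> Lambda J 0 q" "length vs = q"
  shows "\<mu> x vs = \<mu> x (map (proj01 J x) vs)"
proof -
  have S: "{S. S \<subseteq> {..<q} \<and> card S = 0} = {{}}"
    using finite_subset by fastforce
  have "\<mu> x vs = type_proj J 0 q \<mu> x vs"
    using assms(1) by (simp add: Lambda_def)
  also have "\<dots> = \<mu> x (map (\<lambda>i. proj01 J x (vs ! i)) [0..<q])"
    using assms(2) by (simp add: type_proj_def S del: card_eq_0_iff)
  also have "map (\<lambda>i. proj01 J x (vs ! i)) [0..<q] = map (proj01 J x) vs"
    using assms(2) by (auto intro: nth_equalityI)
  finally show ?thesis .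
qed

text \<open>Passing to (1,0) parts turns a (0,1) vector into 0. The list may have any length,
  because forms vanish on lists of the wrong length.\<close>

lemma Lambda_p0_proj01_arg:
  assumes "\<psi> \<in> Lambda J p 0" "J x ** J x = - mat 1" "proj01 J x v \<in> set vs"
  shows "\<psi> x vs = 0"
proof (cases "length vs = p")
  case True
  have "0 \<in> set (map (proj10 J x) vs)"
    using assms(3) proj10_proj01[of J, OF assms(2)] by (metis image_eqI list.set_map)
  then show ?thesis
    using Lambda_p0[OF assms(1) True] cforms_zero_arg[of \<psi> p] assms(1) by (simp add: Lambda_def)
qed (use assms in \<open>simp add: Lambda_def cforms_def\<close>)

section \<open>Exterior derivative and wedge product on arguments of mixed type\<close>

lemma nth_in_set_omit:
  assumes "i < length vs" "i \<noteq> j"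
  shows "vs ! i \<in> set (omit j vs)"
proof (cases "i < j")
  case True
  then have "vs ! i = take j vs ! i" "i < length (take j vs)" using assms by auto
  then show ?thesis unfolding omit_def by (metis UnI1 nth_mem set_append)
next
  case False
  then have "vs ! i = drop (Suc j) vs ! (i - Suc j)" "i - Suc j < length (drop (Suc j) vs)"
    using assms by auto
  then show ?thesis unfolding omit_def by (metis UnI2 nth_mem set_append)
qed

lemma omit_Cons_0: "omit 0 (v # vs) = vs"
  by (simp add: omit_def)

text \<open>If the zero vector is the omitted one, it is the direction of differentiation; otherwise
  it stays among the arguments of the form. Either way the term vanishes.\<close>

lemma ext_d_zero_arg:
  assumes "\<alpha> \<in> cforms r" "i < length vs" "vs ! i = 0"
  shows "ext_d \<alpha> x vs = 0"
  unfolding ext_d_def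
proof (intro sum.neutral ballI)
  fix j
  show "(- 1) ^ j * cderiv (vs ! j) (\<lambda>y. \<alpha> y (omit j vs)) x = 0"
  proof (cases "j = i")
    case True
    then show ?thesis using assms by (simp add: cderiv_def)
  next
    case False
    then have "0 \<in> set (omit j vs)" using nth_in_set_omit[of i vs j] assms by simp
    then show ?thesis using cforms_zero_arg[OF assms(1)] by (simp add: cderiv_const)
  qed
qed

text \<open>A p-element subset of {0..p} other than {1..p} misses some i \<ge> 1. There
  \<open>proj01\<close> is applied to a (1,0) vector and gives 0, so a single term of the projection
  survives.\<close>

lemma type_proj_ext_d:
  assumes \<psi>: "\<psi> \<in> cforms p" and J: "J x ** J x = - mat 1" and vs: "length vs = p"
  shows "type_proj J p 1 (ext_d \<psi>) x (proj01 J x v # map (proj10 J x) vs)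
    = ext_d \<psi> x (proj01 J x v # map (proj10 J x) vs)"
proof -
  define us where "us = proj01 J x v # map (proj10 J x) vs"
  define F where "F S = map (\<lambda>i. if i \<in> S then proj10 J x (us ! i) else proj01 J x (us ! i))
     [0..<p + 1]" for S
  let ?C = "{S. S \<subseteq> {..<p + 1} \<and> card S = p}"
  have len: "length us = p + 1" by (simp add: us_def vs)
  have fin: "finite ?C" by (rule finite_subset[of _ "Pow {..<p + 1}"]) auto
  \<comment> \<open>Position 0 holds the (0,1) vector, so the (1,0) arguments sit at 1..p and
    idempotence of the projections leaves the list unchanged.\<close>
  have F0: "F {1..p} = us"
    unfolding F_def
    by (rule nth_equalityI)
      (auto simp: len vs us_def nth_Cons' simp del: upt_Suc simp: proj10_proj10[of J, OF J] proj01_proj01[of J, OF J])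
  have "type_proj J p 1 (ext_d \<psi>) x us = (\<Sum>S\<in>?C. ext_d \<psi> x (F S))"
    by (simp add: type_proj_def len F_def)
  also have "\<dots> = (\<Sum>S\<in>{{1..p}}. ext_d \<psi> x (F S))"
  proof (rule sum.mono_neutral_right[OF fin])
    show "{{1..p}} \<subseteq> ?C" by auto
    show "\<forall>S\<in>?C - {{1..p}}. ext_d \<psi> x (F S) = 0"
    proof
      fix S assume S: "S \<in> ?C - {{1..p}}"
      then have "finite S" using finite_subset by blast
      then have "\<not> {1..p} \<subseteq> S"
        using S card_subset_eq[of S "{1..p}"] by auto
      then obtain i where i: "1 \<le> i" "i \<le> p" "i \<notin> S"
        by (meson atLeastAtMost_iff subsetI)
      then have "F S ! i = 0"
        by (simp add: F_def us_def vs proj01_proj10[of J, OF J] nth_Cons' del: upt_Suc)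
      then show "ext_d \<psi> x (F S) = 0"
        using ext_d_zero_arg[OF \<psi>, of i] i by (simp add: F_def del: upt_Suc)
    qed
  qed
  finally show ?thesis using F0 by (simp add: us_def)
qed

text \<open>In the formula for d every term but the first keeps the (0,1) vector as an argument of
  \<psi> and vanishes; the first differentiates a coefficient along that vector. Constancy of J lets
  vectors projected at x serve as constant fields of the same type everywhere. The list
  \<open>vs\<close> can be arbitrary because \<psi> sees only (1,0) parts.\<close>

lemma delbar_closed_cderiv:
  assumes \<psi>: "\<psi> \<in> Lambda J p 0" and closed: "delbar J p 0 \<psi> = (\<lambda>x vs. 0)"
    and J: "\<And>y. J y = J x" "J x ** J x = - mat 1" and vs: "length vs = p"
  shows "cderiv (proj01 J x v) (\<lambda>y. \<psi> y vs) x = 0"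
proof -
  define us where "us = proj01 J x v # map (proj10 J x) vs"
  have pr: "proj10 J y = proj10 J x" "proj01 J y = proj01 J x" for y
    using J(1)[of y] by (auto simp: proj10_def proj01_def)
  have \<psi>': "\<psi> \<in> cforms p" using \<psi> by (simp add: Lambda_def)
  have coeff: "\<psi> y (map (proj10 J x) vs) = \<psi> y vs" for y
    using Lambda_p0[OF \<psi> vs, of y] pr(1)[of y] by simp
  have rest: "cderiv (us ! i) (\<lambda>y. \<psi> y (omit i us)) x = 0" if "i \<noteq> 0" for i
  proof -
    have "us ! 0 \<in> set (omit i us)"
      using that by (intro nth_in_set_omit) (auto simp: us_def)
    then have "\<psi> y (omit i us) = 0" for y
      using Lambda_p0_proj01_arg[OF \<psi>, of y v] J(1)[of y] J(2) pr(2)[of y] by (simp add: us_def)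
    then show ?thesis by (simp add: cderiv_const)
  qed
  have "0 = ext_d \<psi> x us"
    using type_proj_ext_d[of \<psi> p J x, OF \<psi>' J(2) vs, of v] fun_cong[OF fun_cong[OF closed]]
    by (simp add: delbar_def us_def)
  also have "\<dots> = (\<Sum>i\<in>{0}. (- 1) ^ i * cderiv (us ! i) (\<lambda>y. \<psi> y (omit i us)) x)"
    unfolding ext_d_def
    by (rule sum.mono_neutral_right) (auto simp: us_def[symmetric] rest, simp add: us_def)
  also have "\<dots> = cderiv (proj01 J x v) (\<lambda>y. \<psi> y vs) x"
    by (simp add: us_def omit_Cons_0 coeff)
  finally show ?thesis by simp
qed

text \<open>At each point, test on a (0,1) vector followed by the (1,0) parts of vectors on which
  \<psi> is nonzero: \<mu> kills the latter, so only one product remains. This gives the uniqueness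
  behind the definite descriptions in \<open>mu_form\<close> and \<open>gamma_form\<close> when
  their left-hand sides vanish.\<close>

lemma wedge1_eq_zero:
  assumes \<psi>: "\<psi> \<in> Lambda J p 0" "nowhere_vanishing \<psi>" and \<mu>: "\<mu> \<in> Lambda J 0 1"
    and J: "\<And>x. J x ** J x = - mat 1"
    and w: "wedge1 \<mu> \<psi> = (\<lambda>x vs. 0)"
  shows "\<mu> = (\<lambda>x vs. 0)"
proof (intro ext)
  fix x us
  have \<mu>': "\<mu> \<in> cforms 1" using \<mu> by (simp add: Lambda_def)
  show "\<mu> x us = 0"
  proof (cases "length us = 1")
    case True
    then obtain v where us: "us = [v]" by (auto simp: length_Suc_conv)
    obtain vs where vs: "\<psi> x vs \<noteq> 0" using \<psi>(2) by (auto simp: nowhere_vanishing_def)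
    then have len: "length vs = p" using \<psi>(1) by (auto simp: Lambda_def cforms_def)
    define ws where "ws = proj01 J x v # map (proj10 J x) vs"
    have rest: "\<mu> x [ws ! i] = 0" if i: "i \<noteq> 0" "i < length ws" for i
    proof -
      have "ws ! i = proj10 J x (vs ! (i - 1))" using i by (simp add: ws_def nth_Cons')
      then have "\<mu> x [ws ! i] = \<mu> x [0]"
        using Lambda_0q[OF \<mu>, of "[ws ! i]" x] by (simp add: proj01_proj10[of J, OF J])
      then show ?thesis using cforms_zero_arg[OF \<mu>', of "[0]"] by simp
    qed
    have "0 = wedge1 \<mu> \<psi> x ws" by (simp add: w)
    also have "\<dots> = (\<Sum>i\<in>{0}. (- 1) ^ i * \<mu> x [ws ! i] * \<psi> x (omit i ws))"
      unfolding wedge1_def by (rule sum.mono_neutral_right) (auto simp: rest, simp add: ws_def)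
    also have "\<dots> = \<mu> x us * \<psi> x vs"
      using Lambda_p0[OF \<psi>(1) len, of x] Lambda_0q[OF \<mu> True, of x]
      by (simp add: us ws_def omit_Cons_0)
    finally show ?thesis using vs by simp
  qed (use \<mu>' in \<open>simp add: cforms_def\<close>)
qed

lemma zero_in_Lambda: "(\<lambda>x vs. 0) \<in> Lambda J p q"
  by (auto simp: Lambda_def cforms_def periodic_const smooth_const type_proj_def fun_eq_iff)

lemma ext_d_const:
  assumes "\<And>x vs. \<alpha> x vs = \<beta> vs"
  shows "ext_d \<alpha> = (\<lambda>x vs. 0)"
  by (simp add: ext_d_def assms cderiv_const fun_eq_iff)

lemma type_proj_zero: "type_proj J p q (\<lambda>x vs. 0) = (\<lambda>x vs. 0)"
  by (simp add: type_proj_def fun_eq_iff)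

section \<open>The standard structure\<close>

lemma J_std_square: "J_std x ** J_std x = - mat 1"
proof -
  have "(J_std x ** J_std x) *v v = (- mat 1) *v v" for v :: "'a rvec"
    by (simp add: matrix_vector_mul_assoc[symmetric] J_std_times vec_eq_iff
        matrix_vector_mult_minus split: sum.splits)
  then show ?thesis by (simp add: matrix_eq)
qed

lemma J_std_const: "J_std = (\<lambda>x. J_std 0)"
  by (simp add: J_std_def fun_eq_iff)

lemma cmat_of_times_cvec_of: "cmat_of A *v cvec_of v = cvec_of (A *v v)"
  by (simp add: cmat_of_def cvec_of_def matrix_vector_mult_def vec_eq_iff)

lemma cmat_of_J_std_times:
  "cmat_of (J_std x) *v v = (\<chi> k. case k of Inl \<alpha> \<Rightarrow> - v $ Inr \<alpha> | Inr \<alpha> \<Rightarrow> v $ Inl \<alpha>)"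
proof -
  \<comment> \<open>Splitting v into real and imaginary parts reduces the claim to the known action
    on real vectors.\<close>
  have "cmat_of (J_std x) *v v = cmat_of (J_std x) *v (cvec_of (\<chi> i. Re (v $ i)) + \<i> *s cvec_of (\<chi> i. Im (v $ i)))"
    by (rule arg_cong[where f = "\<lambda>v. _ *v v"]) (simp add: vec_eq_iff cvec_of_def complex_eq_iff)
  also have "\<dots> = (\<chi> k. case k of Inl \<alpha> \<Rightarrow> - v $ Inr \<alpha> | Inr \<alpha> \<Rightarrow> v $ Inl \<alpha>)"
    by (simp add: matrix_vector_right_distrib vector_scalar_commute cmat_of_times_cvec_of J_std_times)
      (auto simp: vec_eq_iff cvec_of_def complex_eq_iff split: sum.splits)
  finally show ?thesis .
qed

lemma omega_std_eq:
  "omega_std x v w = (\<Sum>\<alpha>\<in>UNIV. v $ Inl \<alpha> * w $ Inr \<alpha> - v $ Inr \<alpha> * w $ Inl \<alpha>)"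
  by (auto simp: omega_std_def omega_cform_def wedge1_def omit_def dz_def sum_distrib_left sum_negf[symmetric]
      dzbar_def cvec_of_def lessThan_Suc algebra_simps intro!: sum.cong)

lemma sum_UNIV_Plus:
  "(\<Sum>k\<in>(UNIV::('a::finite + 'b::finite) set). f k) = (\<Sum>\<alpha>\<in>UNIV. f (Inl \<alpha>)) + (\<Sum>\<beta>\<in>UNIV. f (Inr \<beta>))"
  by (simp add: UNIV_Plus_UNIV[symmetric] sum.Plus del: UNIV_Plus_UNIV)

text \<open>Yields positivity in \<open>calibrated_std\<close> and turns
  \<open>transpose_wrt\<close> into the Euclidean adjoint.\<close>

lemma metric_of_std: "metric_of omega_std J_std x v w = v \<bullet> w"
  by (simp add: metric_of_def omega_std_eq J_std_times inner_vec_def sum_UNIV_Plus sum.distrib)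

lemma calibrated_std: "calibrated omega_std J_std"
  unfolding calibrated_def almost_complex_def
proof (intro conjI allI impI)
  show "J_std \<in> (endos :: 'a endo set)"
    by (subst J_std_const) (simp add: endos_def smooth_const periodic_const)
  show "omega_std x (J_std x *v v) (J_std x *v w) = omega_std x v w" for x v w :: "'a rvec"
    by (simp add: omega_std_eq J_std_times algebra_simps)
  show "0 < omega_std x v (J_std x *v v)" if "v \<noteq> 0" for x v :: "'a rvec"
    using metric_of_std[of x v v] that by (simp add: metric_of_def)
qed (rule J_std_square)

section \<open>Constancy of closed volume forms and vanishing of \<theta>\<close>

lemma delbar_closed_periodic_const:
  fixes f :: "'n::finite rvec \<Rightarrow> complex"
  assumes f: "smooth f" "periodic f"
    and cr: "\<And>x v. cderiv (proj01 J_std x v) f x = 0"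
  shows "f x = f y"
proof -
  have der: "(f has_derivative frechet_derivative f (at x)) (at x)" for x
    using smooth_differentiable[OF f(1)] by (simp add: frechet_derivative_works[symmetric])
  have bdd: "bounded (range f)"
    using f by (intro periodic_continuous_bounded smooth_continuous)
  \<comment> \<open>The (0,1) part of the field d/dx_\<alpha> is (d/dx_\<alpha> + i
    d/dy_\<alpha>)/2, so the hypothesis is the Cauchy-Riemann equation in the single variable
    z_\<alpha>.\<close>
  have CR: "frechet_derivative f (at x) (axis (Inr \<alpha>) 1) = \<i> * frechet_derivative f (at x) (axis (Inl \<alpha>) 1)"
    for x \<alpha>
  proof -
    let ?D = "\<lambda>j. frechet_derivative f (at x) (axis j 1)"
    have p: "proj01 J_std x (axis (Inl \<alpha>) 1) $ j =
        (if j = Inl \<alpha> then 1/2 else 0) + (if j = Inr \<alpha> then \<i>/2 else 0)" for j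
      by (auto simp: proj01_def cmat_of_J_std_times axis_def split: sum.splits)
    have "0 = (\<Sum>j\<in>UNIV. ((if j = Inl \<alpha> then 1/2 else 0) + (if j = Inr \<alpha> then \<i>/2 else 0)) * ?D j)"
      using cr[of x "axis (Inl \<alpha>) 1"] by (simp add: cderiv_def p)
    also have "\<dots> = ?D (Inl \<alpha>) / 2 + \<i> * ?D (Inr \<alpha>) / 2"
      by (simp add: distrib_right sum.distrib mult_delta_left)
    finally have "?D (Inl \<alpha>) + \<i> * ?D (Inr \<alpha>) = 0" by algebra
    then show ?thesis by (simp add: complex_eq_iff)
  qed
  have zero: "frechet_derivative f (at x) (axis (Inl \<alpha>) 1) = 0" for x \<alpha>
  proof -
    let ?a = "axis (Inl \<alpha>) 1 :: 'n rvec" and ?b = "axis (Inr \<alpha>) 1 :: 'n rvec"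
    \<comment> \<open>The complex line through x in the direction of z_\<alpha>; holomorphy along
      each such line is all that Liouville's theorem in one variable asks for besides
      boundedness.\<close>
    define l where "l z = x + (Re z *\<^sub>R ?a + Im z *\<^sub>R ?b)" for z
    have l': "(l has_derivative (\<lambda>h. Re h *\<^sub>R ?a + Im h *\<^sub>R ?b)) (at z)" for z
      unfolding l_def by (auto intro!: derivative_eq_intros)
    have fd: "((\<lambda>z. f (l z)) has_field_derivative frechet_derivative f (at (l z)) ?a) (at z)" for z
    proof -
      interpret D: bounded_linear "frechet_derivative f (at (l z))"
        using der has_derivative_bounded_linear by blast
      have "((\<lambda>z. f (l z)) has_derivative
          (\<lambda>h. frechet_derivative f (at (l z)) (Re h *\<^sub>R ?a + Im h *\<^sub>R ?b))) (at z)"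
        using has_derivative_compose[OF l' der] .
      moreover have "(\<lambda>h. frechet_derivative f (at (l z)) (Re h *\<^sub>R ?a + Im h *\<^sub>R ?b))
          = (*) (frechet_derivative f (at (l z)) ?a)"
        by (auto simp: D.add D.scaleR CR complex_eq_iff algebra_simps)
      ultimately show ?thesis by (simp add: has_field_derivative_def)
    qed
    have "(\<lambda>z. f (l z)) holomorphic_on UNIV"
      using fd by (meson holomorphic_on_open open_UNIV)
    moreover have "bounded (range (\<lambda>z. f (l z)))"
      using bdd by (rule bounded_subset) auto
    ultimately obtain c where "\<And>z. f (l z) = c"
      using Liouville_theorem[of "\<lambda>z. f (l z)"] by (auto simp: constant_on_def)
    \<comment> \<open>Since \<open>l 0 = x\<close>, the partial derivative of f at x is the
      derivative of a constant.\<close>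
    then have "((\<lambda>z. c) has_field_derivative frechet_derivative f (at (l 0)) ?a) (at 0)"
      using fd[of 0] by simp
    then show ?thesis using DERIV_unique[OF _ DERIV_const] by (force simp: l_def)
  qed
  have "frechet_derivative f (at x) = (\<lambda>h. 0)" for x
  proof
    fix h :: "'n rvec"
    interpret D: bounded_linear "frechet_derivative f (at x)"
      using der has_derivative_bounded_linear by blast
    have "frechet_derivative f (at x) (axis i 1) = 0" for i
      by (cases i) (auto simp: zero CR)
    then have "frechet_derivative f (at x) (\<Sum>i\<in>UNIV. h $ i *\<^sub>R axis i 1) = 0"
      by (simp add: D.sum D.scaleR)
    then show "frechet_derivative f (at x) h = 0"
      using basis_expansion[of h] by (simp add: scalar_mult_eq_scaleR)
  qed
  then have "(f has_derivative (\<lambda>h. 0)) (at x within UNIV)" for x using der[of x] by simp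
  then show ?thesis
    using has_derivative_zero_unique[of UNIV f x y] by auto
qed

lemma closed_volume_form_const:
  fixes \<psi> :: "'n::finite cform"
  assumes "\<psi> \<in> closed_volume_forms J_std"
  shows "\<psi> x vs = \<psi> 0 vs"
proof (cases "length vs = CARD('n)")
  case True
  have \<psi>: "\<psi> \<in> Lambda J_std CARD('n) 0" "delbar J_std CARD('n) 0 \<psi> = (\<lambda>x vs. 0)"
    using assms by (auto simp: closed_volume_forms_def)
  have J: "J_std y = (J_std x :: ('n rvec, 'n + 'n) vec)" for x y using J_std_const by metis
  show ?thesis
  proof (rule delbar_closed_periodic_const[where f = "\<lambda>x. \<psi> x vs"])
    show "smooth (\<lambda>x. \<psi> x vs)" "periodic (\<lambda>x. \<psi> x vs)"
      using \<psi>(1) by (auto simp: Lambda_def cforms_def periodic_def)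
    show "cderiv (proj01 J_std x v) (\<lambda>x. \<psi> x vs) x = 0" for x v
      by (rule delbar_closed_cderiv[OF \<psi> J J_std_square True])
  qed
qed (use assms in \<open>auto simp: closed_volume_forms_def Lambda_def cforms_def\<close>)

lemma theta_form_std:
  fixes \<psi> :: "'n::finite cform"
  assumes \<psi>: "\<psi> \<in> closed_volume_forms J_std" and L: "\<And>x. L x = L 0"
  shows "theta_form J_std L \<psi> = (\<lambda>x vs. 0)"
proof -
  note const = closed_volume_form_const[OF \<psi>]
  \<comment> \<open>With constant coefficients both defining equations become 0 = \<mu> \<and>
    \<psi>, so one description evaluates both \<open>mu_form\<close> and
    \<open>gamma_form\<close>.\<close>
  have unique: "(THE \<mu>. \<mu> \<in> Lambda J_std 0 1 \<and> (\<lambda>x vs. 0) = wedge1 \<mu> \<psi>) = (\<lambda>x vs. 0)"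
  proof (rule the_equality)
    show "(\<lambda>x vs. 0) \<in> Lambda J_std 0 1 \<and> (\<lambda>x vs. 0) = wedge1 (\<lambda>x vs. 0) \<psi>"
      by (simp add: zero_in_Lambda wedge1_def fun_eq_iff)
    show "\<mu> = (\<lambda>x vs. 0)" if "\<mu> \<in> Lambda J_std 0 1 \<and> (\<lambda>x vs. 0) = wedge1 \<mu> \<psi>" for \<mu>
    proof (rule wedge1_eq_zero)
      show "\<psi> \<in> Lambda J_std CARD('n) 0" "nowhere_vanishing \<psi>"
        using \<psi> by (simp_all add: closed_volume_forms_def)
      show "\<mu> \<in> Lambda J_std 0 1" "wedge1 \<mu> \<psi> = (\<lambda>x vs. 0)" using that by simp_all
    qed (rule J_std_square)
  qed
  have "ext_d \<psi> = (\<lambda>x vs. 0)"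
    by (rule ext_d_const[OF const])
  then have "tau L (Abar J_std CARD('n) 0 \<psi>) = (\<lambda>x vs. 0)"
    by (simp add: Abar_def type_proj_zero) (simp add: tau_def[abs_def])
  then have "mu_form J_std L \<psi> = (\<lambda>x vs. 0)"
    using unique by (simp add: mu_form_def type_proj_zero)
  moreover have "ext_d (tau L \<psi>) = (\<lambda>x vs. 0)"
  proof (rule ext_d_const)
    show "tau L \<psi> x vs = tau L \<psi> 0 vs" for x vs
      unfolding tau_def const[of x] L[of x] ..
  qed
  then have "gamma_form J_std L \<psi> = (\<lambda>x vs. 0)"
    using unique by (simp add: gamma_form_def del_def type_proj_zero)
  ultimately show ?thesis by (simp add: theta_form_def fun_eq_iff)
qed

section \<open>The standard holomorphic volume form\<close>

text \<open>Translates an update at list position \<open>g a\<close> into a change of row a, the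
  shape in which determinants are additive and homogeneous.\<close>

lemma rows_list_update:
  fixes g :: "'n::finite \<Rightarrow> nat" and D :: "'a \<Rightarrow> complex ^ 'n"
  assumes "inj g" "i = g a" "length vs = CARD('n)" "i < CARD('n)"
  shows "(\<chi> b. D (vs[i := u] ! g b)) = (\<chi> b. if b = a then D u else D (vs ! g b))"
  using assms by (auto simp: vec_eq_iff nth_list_update inj_eq)

lemma closed_volume_forms_std_nonempty: "closed_volume_forms (J_std :: 'n::finite endo) \<noteq> {}"
proof -
  \<comment> \<open>The index type carries no order, so an enumeration matches matrix rows with list
    positions.\<close>
  obtain g :: "'n \<Rightarrow> nat" where g: "bij_betw g UNIV {..<CARD('n)}"
    using ex_bij_betw_finite_nat[of "UNIV :: 'n set"] by (auto simp: atLeast0LessThan)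
  have inj: "inj g" and lt: "g a < CARD('n)" for a
    using g by (auto simp: bij_betw_def)
  have surj: "\<exists>a. i = g a" if "i < CARD('n)" for i
    using g that by (auto simp: bij_betw_def image_iff set_eq_iff)
  define D :: "'n cvec \<Rightarrow> complex ^ 'n" where "D v = (\<chi> \<alpha>. v $ Inl \<alpha> + \<i> * v $ Inr \<alpha>)" for v
  \<comment> \<open>The wedge product of all dz_\<alpha>, in the order given by g, as the
    determinant of their values on the arguments.\<close>
  define \<beta> where "\<beta> vs = (if length vs = CARD('n) then det (\<chi> a. D (vs ! g a)) else 0)" for vs
  define \<psi> :: "'n cform" where "\<psi> = (\<lambda>x. \<beta>)"
  have upd: "\<beta> (vs[g a := u]) = det (\<chi> b. if b = a then D u else D (vs ! g b))"
    if "length vs = CARD('n)" for vs a u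
    using that rows_list_update[OF inj refl that lt] by (simp add: \<beta>_def)
  have "\<psi> \<in> cforms CARD('n)"
    unfolding cforms_def mem_Collect_eq
  proof (intro conjI allI impI)
    show "periodic \<psi>" by (simp add: \<psi>_def periodic_const)
    show "smooth (\<lambda>x. \<psi> x vs)" for vs by (simp add: \<psi>_def smooth_const)
    show "\<psi> x vs = 0" if "length vs \<noteq> CARD('n)" for x vs using that by (simp add: \<psi>_def \<beta>_def)
    show "\<psi> x (vs[i := u + v]) = \<psi> x (vs[i := u]) + \<psi> x (vs[i := v])"
      if A: "length vs = CARD('n) \<and> i < CARD('n)" for x vs i u v
    proof -
      obtain a where "i = g a" using A surj by blast
      moreover have "D (u + v) = D u + D v" by (simp add: D_def vec_eq_iff algebra_simps)
      ultimately show ?thesis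
        using A det_row_add[of a "\<lambda>_. D u" "\<lambda>_. D v" "\<lambda>b. D (vs ! g b)"]
        by (simp add: \<psi>_def upd cong: if_cong)
    qed
    show "\<psi> x (vs[i := c *s v]) = c * \<psi> x (vs[i := v])"
      if A: "length vs = CARD('n) \<and> i < CARD('n)" for x vs i c v
    proof -
      obtain a where "i = g a" using A surj by blast
      moreover have "D (c *s v) = c *s D v" by (simp add: D_def vec_eq_iff algebra_simps)
      ultimately show ?thesis
        using A det_row_mul[of a c "\<lambda>_. D v" "\<lambda>b. D (vs ! g b)"]
        by (simp add: \<psi>_def upd cong: if_cong)
    qed
    show "\<psi> x vs = 0" if A: "length vs = CARD('n) \<and> i < j \<and> j < CARD('n) \<and> vs ! i = vs ! j"
      for x vs i j
    proof -
      obtain a b where "i = g a" "j = g b" using A surj by (meson less_trans)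
      then have "det (\<chi> a. D (vs ! g a)) = 0"
        using A by (intro det_identical_rows[of a b]) (auto simp: row_def)
      then show ?thesis using A by (simp add: \<psi>_def \<beta>_def)
    qed
  qed
  moreover have "type_proj J_std CARD('n) 0 \<psi> = \<psi>"
  proof (intro ext)
    fix x :: "'n rvec" and vs :: "'n cvec list"
    have S: "{S. S \<subseteq> {..<CARD('n)} \<and> card S = CARD('n)} = {{..<CARD('n)}}"
      using card_subset_eq[of "{..<CARD('n)}"] by auto
    have "D (proj10 J_std x v) = D v" for v
      by (simp add: D_def proj10_def cmat_of_J_std_times vec_eq_iff algebra_simps)
    then show "type_proj J_std CARD('n) 0 \<psi> x vs = \<psi> x vs"
      using lt by (simp add: type_proj_def S \<psi>_def \<beta>_def)
  qed
  moreover have "nowhere_vanishing \<psi>"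
    unfolding nowhere_vanishing_def
  proof
    fix x
    \<comment> \<open>The fields d/dx_\<alpha> in the order of g, for which that matrix is the
      identity.\<close>
    define vs :: "'n cvec list" where "vs = map (\<lambda>i. axis (Inl (inv g i)) 1) [0..<CARD('n)]"
    have "(\<chi> a. D (vs ! g a)) = mat 1"
      using lt by (auto simp: vs_def vec_eq_iff D_def mat_def axis_def inv_f_f[OF inj])
    then have "\<psi> x vs = 1" by (simp add: \<psi>_def \<beta>_def vs_def)
    then show "\<exists>vs. \<psi> x vs \<noteq> 0" by (metis zero_neq_one)
  qed
  moreover have "delbar J_std CARD('n) 0 \<psi> = (\<lambda>x vs. 0)"
    using ext_d_const[of \<psi> \<beta>] by (simp add: delbar_def \<psi>_def type_proj_zero)
  ultimately have "\<psi> \<in> closed_volume_forms J_std"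
    by (simp add: closed_volume_forms_def Lambda_def)
  then show ?thesis by blast
qed

text \<open>Existence of a closed volume form matters here: without one, every form would satisfy
  the description of \<open>theta\<close>.\<close>

lemma theta_std:
  assumes "\<And>x. L x = L 0"
  shows "theta J_std L = (\<lambda>x vs. 0)"
  unfolding theta_def
  using closed_volume_forms_std_nonempty theta_form_std[of _ L, OF _ assms]
  by (intro the_equality) auto

section \<open>A non-trivial deformation\<close>

text \<open>Complex conjugation in every coordinate z_\<alpha>: constant, symmetric and antilinear,
  hence a candidate for L.\<close>

definition conj_endo :: "'n::finite endo" where
  "conj_endo x = matrix (\<lambda>v. \<chi> k. case k of Inl \<alpha> \<Rightarrow> v $ Inl \<alpha> | Inr \<alpha> \<Rightarrow> - v $ Inr \<alpha>)"

lemma conj_endo_times: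
  "conj_endo x *v v = (\<chi> k. case k of Inl \<alpha> \<Rightarrow> v $ Inl \<alpha> | Inr \<alpha> \<Rightarrow> - v $ Inr \<alpha>)"
proof -
  have "linear (\<lambda>v::'a rvec. \<chi> k. case k of Inl \<alpha> \<Rightarrow> v $ Inl \<alpha> | Inr \<alpha> \<Rightarrow> - v $ Inr \<alpha>)"
    by (auto simp: linear_iff vec_eq_iff split: sum.splits)
  then show ?thesis
    by (simp add: conj_endo_def matrix_works linear_matrix_vector_mul_eq)
qed

lemma transpose_wrt_std_conj_endo:
  "transpose_wrt (metric_of omega_std J_std) conj_endo = conj_endo"
proof
  fix x :: "'n::finite rvec"
  have sym: "(conj_endo x *v v) \<bullet> w = v \<bullet> (conj_endo x *v w)" for v w :: "'n rvec"
    by (simp add: inner_vec_def conj_endo_times sum_UNIV_Plus)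
  show "transpose_wrt (metric_of omega_std J_std) conj_endo x = conj_endo x"
    unfolding transpose_wrt_def metric_of_std
  proof (rule the_equality)
    fix M :: "('n rvec, 'n + 'n) vec"
    assume "\<forall>v w. (conj_endo x *v v) \<bullet> w = v \<bullet> (M *v w)"
    then have "v \<bullet> (conj_endo x *v w) = v \<bullet> (M *v w)" for v w by (metis sym)
    then have "conj_endo x *v w = M *v w" for w using vector_eq_ldot by blast
    then show "M = conj_endo x" by (simp add: matrix_eq)
  qed (simp add: sym)
qed

lemma conj_endo_inf_deformation:
  "(\<lambda>x. J_std x ** conj_endo x) \<in> inf_deformations omega_std (J_std :: 'n::finite endo)"
proof -
  have "conj_endo \<in> (endos :: 'n endo set)"
    by (simp add: endos_def conj_endo_def[abs_def] smooth_const periodic_const)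
  moreover have "conj_endo x ** J_std x = - (J_std x ** conj_endo x)" for x :: "'n rvec"
  proof -
    have "(conj_endo x ** J_std x) *v v = (- (J_std x ** conj_endo x)) *v v" for v
      by (simp add: matrix_vector_mul_assoc[symmetric] conj_endo_times J_std_times vec_eq_iff
          matrix_vector_mult_minus split: sum.splits)
    then show ?thesis by (simp add: matrix_eq)
  qed
  moreover have "delbar_exact J_std (theta J_std (conj_endo :: 'n endo))"
  proof -
    \<comment> \<open>Since \<theta> vanishes, h = 0 is a primitive.\<close>
    have "delbar J_std 0 0 (form_of_fun (\<lambda>x::'n rvec. 0)) = (\<lambda>x vs. 0 :: complex)"
      by (subst delbar_def, subst ext_d_const[of _ "\<lambda>vs. 0"])
        (simp_all add: form_of_fun_def type_proj_zero)
    moreover have "theta J_std (conj_endo :: 'n endo) = (\<lambda>x vs. 0)"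
      by (rule theta_std) (simp add: conj_endo_def)
    moreover have "(\<lambda>x::'n rvec. 0) \<in> cfunctions"
      by (simp add: cfunctions_def smooth_const periodic_const)
    ultimately show ?thesis unfolding delbar_exact_def by metis
  qed
  ultimately show ?thesis
    unfolding inf_deformations_def by (auto simp: transpose_wrt_std_conj_endo)
qed

section \<open>Lie derivatives of the standard structures\<close>

lemma lie_bracket_const_right: "lie_bracket X (\<lambda>_. v) x = - frechet_derivative X (at x) v"
  by (simp add: lie_bracket_def frechet_derivative_const)

text \<open>The symplectic form has constant coefficients, so only the bracket terms remain, and
  their signs cancel against [X, v] = -DX(v).\<close>

lemma lie_bilin_omega_std:
  "lie_bilin X omega_std x v w =
     omega_std x (frechet_derivative X (at x) v) w + omega_std x v (frechet_derivative X (at x) w)"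
proof -
  have "(\<lambda>y. omega_std y v w) = (\<lambda>y. omega_std x v w)" by (simp add: omega_std_eq)
  then have "frechet_derivative (\<lambda>y. omega_std y v w) (at x) (X x) = 0"
    by (simp add: frechet_derivative_const)
  then show ?thesis
    by (simp add: lie_bilin_def lie_bracket_const_right)
      (simp add: omega_std_eq sum.distrib[symmetric] sum_negf[symmetric] sum_subtractf[symmetric]
        algebra_simps)
qed

text \<open>For constant J the Lie derivative is the commutator of J with DX. Smoothness of X makes
  DX linear, so that \<open>matrix\<close> represents this map faithfully.\<close>

lemma lie_endo_J_std:
  assumes "smooth X"
  shows "lie_endo X J_std x *v v =
    J_std x *v frechet_derivative X (at x) v - frechet_derivative X (at x) (J_std x *v v)"
proof -
  let ?D = "frechet_derivative X (at x)"
  have "bounded_linear ?D"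
    using smooth_differentiable[OF assms] frechet_derivative_works has_derivative_bounded_linear by blast
  then have lin: "linear ?D" by (rule bounded_linear.linear)
  have "lie_endo X J_std x = matrix (\<lambda>v. J_std x *v ?D v - ?D (J_std x *v v))"
  proof -
    have "(\<lambda>y. J_std y *v v) = (\<lambda>y. J_std x *v v)" for v by (subst (1 2) J_std_const) simp
    then show ?thesis
      by (simp add: lie_endo_def lie_bracket_const_right matrix_vector_mult_minus
          linear_neg[OF matrix_vector_mul_linear])
  qed
  moreover have "linear (\<lambda>v. J_std x *v ?D v - ?D (J_std x *v v))"
    by (intro linear_compose_sub linear_compose[OF lin, unfolded o_def]
        linear_compose[OF _ lin, unfolded o_def] matrix_vector_mul_linear)
  ultimately show ?thesis by (simp add: matrix_works)
qed

text \<open>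
  Along the circle in direction \<open>x_\<alpha>\<close> the two conditions on \<open>X\<close> read
  \<open>\<partial>X_x/\<partial>x - \<partial>X_y/\<partial>y = 1\<close> and \<open>\<partial>X_x/\<partial>x + \<partial>X_y/\<partial>y = 0\<close>, so the periodic function \<open>X_x\<close> would
  have constant derivative \<open>1/2\<close>.
\<close>

lemma conj_endo_not_trivial:
  "(\<lambda>x. J_std x ** conj_endo x) \<notin> trivial_deformations omega_std (J_std :: 'n::finite endo)"
proof
  assume "(\<lambda>x. J_std x ** conj_endo x) \<in> trivial_deformations omega_std (J_std :: 'n endo)"
  then obtain X :: "'n vfield" where X: "smooth X" "periodic X"
    and lie: "(\<lambda>x. J_std x ** conj_endo x) = lie_endo X J_std"
    and symp: "\<And>x v w. lie_bilin X omega_std x v w = 0"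
    by (auto simp: trivial_deformations_def vfields_def)
  \<comment> \<open>Any coordinate will do; types are inhabited, so n \<ge> 1.\<close>
  obtain \<alpha> :: 'n where True by simp
  let ?a = "axis (Inl \<alpha>) 1 :: 'n rvec" and ?b = "axis (Inr \<alpha>) 1 :: 'n rvec"
  have half: "frechet_derivative X (at x) ?a $ Inl \<alpha> = 1/2" for x
  proof -
    let ?D = "frechet_derivative X (at x)"
    have "J_std x *v ?a = ?b" by (auto simp: J_std_times vec_eq_iff axis_def split: sum.splits)
    moreover have "(J_std x ** conj_endo x) *v ?a = ?b"
      by (auto simp: matrix_vector_mul_assoc[symmetric] J_std_times conj_endo_times vec_eq_iff axis_def
          split: sum.splits)
    \<comment> \<open>Both sides are applied to d/dx_\<alpha> and compared in the y_\<alpha>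
      component.\<close>
    ultimately have "?b $ Inr \<alpha> = (J_std x *v ?D ?a - ?D ?b) $ Inr \<alpha>"
      using lie_endo_J_std[OF X(1), of x ?a] fun_cong[OF lie, of x] by simp
    then have "?D ?a $ Inl \<alpha> - ?D ?b $ Inr \<alpha> = 1" by (simp add: J_std_times)
    moreover have "?D ?a $ Inl \<alpha> + ?D ?b $ Inr \<alpha> = 0"
      using symp[of x ?a ?b]
      by (simp add: lie_bilin_omega_std omega_std_eq axis_def sum.distrib mult_delta_left mult_delta_right)
    ultimately show ?thesis by linarith
  qed
  define f where "f t = X (t *\<^sub>R ?a) $ Inl \<alpha>" for t
  have "(f has_real_derivative 1/2) (at t)" for t
  proof -
    let ?D = "frechet_derivative X (at (t *\<^sub>R ?a))"
    have D: "(X has_derivative ?D) (at (t *\<^sub>R ?a))"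
      using smooth_differentiable[OF X(1)] by (simp add: frechet_derivative_works[symmetric])
    then interpret D: bounded_linear ?D by (rule has_derivative_bounded_linear)
    have "((\<lambda>t. t *\<^sub>R ?a) has_derivative (\<lambda>h. h *\<^sub>R ?a)) (at t)"
      by (auto intro!: derivative_eq_intros)
    from has_derivative_compose[OF this D]
    have "((\<lambda>t. X (t *\<^sub>R ?a)) has_derivative (\<lambda>h. ?D (h *\<^sub>R ?a))) (at t)" .
    from bounded_linear.has_derivative[OF bounded_linear_vec_nth this]
    have "(f has_derivative (\<lambda>h. ?D (h *\<^sub>R ?a) $ Inl \<alpha>)) (at t)" unfolding f_def .
    moreover have "(\<lambda>h. ?D (h *\<^sub>R ?a) $ Inl \<alpha>) = (*) (1/2)" by (auto simp: D.scaleR half)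
    ultimately show ?thesis by (simp add: has_field_derivative_def)
  qed
  \<comment> \<open>The segment from t = 0 to t = 1 closes up on the torus, yet f would grow by 1/2
    along it.\<close>
  then obtain z where "f 1 - f 0 = (1 - 0) * (1/2)"
    using MVT2[of 0 1 f "\<lambda>_. 1/2"] by auto
  moreover have "f 1 = f 0"
    using X(2)[unfolded periodic_def, rule_format, of ?a 0] by (simp add: f_def axis_def)
  ultimately show False by simp
qed

text \<open>The field X = 0 generates it. This puts every endomorphism field into its own
  coset.\<close>

lemma zero_trivial_deformation: "(\<lambda>x. 0) \<in> trivial_deformations omega_std J_std"
proof -
  have "lie_endo (\<lambda>x. 0) J_std = (\<lambda>x. 0)"
    by (auto simp: matrix_eq lie_endo_J_std[OF smooth_const] frechet_derivative_const)
  moreover have "lie_bilin (\<lambda>x. 0) omega_std x v w = 0" for x v w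
    by (simp add: lie_bilin_omega_std frechet_derivative_const omega_std_eq)
  moreover have "(\<lambda>x. 0) \<in> vfields" by (simp add: vfields_def smooth_const periodic_const)
  ultimately show ?thesis unfolding trivial_deformations_def by (force simp: eq_commute[of _ "lie_endo _ _"])
qed

theorem mainTheorem3:
  shows "(J_std :: 'n::finite endo) \<in> admissible omega_std \<and>
         \<not> rigid omega_std (J_std :: 'n::finite endo)"
proof
  show "(J_std :: 'n endo) \<in> admissible omega_std"
    by (simp add: admissible_def calibrated_std closed_volume_forms_std_nonempty)
  let ?A = "\<lambda>x. J_std x ** conj_endo x :: ('n rvec, 'n + 'n) vec"
  let ?T = "trivial_deformations omega_std (J_std :: 'n endo)"
  show "\<not> rigid omega_std (J_std :: 'n endo)"
  proof
    assume "rigid omega_std (J_std :: 'n endo)"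
    \<comment> \<open>Rigidity identifies every class with the class of 0, whose elements are
      exactly the trivial deformations.\<close>
    then have "endo_coset ?T ?A = endo_coset ?T (\<lambda>x. 0)"
      using conj_endo_inf_deformation unfolding rigid_def virtual_tangent_def by blast
    moreover have "?A \<in> endo_coset ?T ?A"
      using zero_trivial_deformation by (force simp: endo_coset_def)
    ultimately have "?A \<in> ?T" by (simp add: endo_coset_def)
    then show False using conj_endo_not_trivial by blast
  qed
qed

end
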